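(* Consider the scalar event-triggered control system described in the context, with $A>0$, $B\ne0$, delay bound $\gamma$, triggering function $v(t)=v_0e^{-\sigma t}$ ($v_0,\sigma>0$), and design parameter $0<\rho_0<1$. If the state estimation error satisfies $|z(0)|<v_0$, then for any information transmission rate $$R_s\ \ge\ \frac{A+\sigma}{-\ln(\rho_0e^{-\sigma\gamma})}\ \max\left\{0,\ 1+\log\frac{b\gamma(A+\sigma)}{\ln\left(1+\rho_0e^{-(\sigma+A)\gamma}\right)}\right\},$$ where $b>1$, there exists a quantization policy that achieves $$|z(t_c^{k+})|=|z(t_c^k)-\bar z(t_c^k)|\le\rho_0e^{-\sigma\gamma}v(t_s^k)\quad\text{for all } t_c^k\in[t_s^k,t_s^k+\gamma]\text{ and all }k\in\mathbb{N}$$ (and consequently $|z(t)|\le v_0e^{(A+\sigma)\gamma}e^{-\sigma t}$).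
   Context: $\log$ is the logarithm to base $2$, $\ln$ the natural logarithm, $\mathbb{N}$ the positive integers, $f(t^+)$ the right limit of $f$ at $t$. Plant and channel. $\dot x(t)=Ax(t)+Bu(t)$, $x(t),u(t)\in\mathbb{R}$, $A>0$, $B\ne 0$ real, $|x(0)|<L$ with $L$ known to sensor and controller. The sensor measures $x$ exactly. At times $t_s^k$ ($k\in\mathbb{N}$) the sensor transmits a packet of $g(t_s^k)$ bits, received by the controller without error at time $t_c^k$; the communication delay $\Delta_k=t_c^k-t_s^k$ is unknown, arbitrary, and satisfies $0\le\Delta_k\le\gamma$, with $\gamma$ known to both. Triggering intervals: $\Delta'_k=t_s^{k+1}-t_s^k$. Estimator and triggering. Between receptions the controller's estimate obeys $\dot{\hat x}=A\hat x+Bu$; the sensor can also compute $\hat x$. The state estimation error is $z=x-\hat x$. With the event-triggering function $v(t)=v_0e^{-\sigma t}$, known to both, a transmission occurs whenever $|z(t)|=v(t)$. On reception the estimate jumps: $\hat x(t_c^+)=\bar z(t_c)+\hat x(t_c)$, where $\bar z(t_c)$ is an estimate of $z(t_c)$ constructed by the controller from the knowledge that $|z(t_s)|=v(t_s)$, the delay bound, the reception time $t_c$, and the decoded packet. A quantization policy is a choice of the packets (their sizes and contents, as determined by the sensor at the triggering times) and of the corresponding decoding rule producing $\bar z(t_c)$. Information transmission rate: $R_s=\limsup_{N\to\infty}\dfrac{\sum_{k=1}^N g(t_s^k)}{\sum_{k=1}^N\Delta'_k}$. *)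

theory Defs
  imports "HOL-Analysis.Analysis"
begin

text \<open>
  Logarithm to base 2 of a nonnegative real, with the usual convention \<open>log 0 = -\<infinity>\<close>
  (the library's \<^const>\<open>log\<close> takes the value 0 at 0). The argument 0 arises only for zero delay
  bound.
\<close>

definition elog2 :: "real \<Rightarrow> ereal" where
  "elog2 x = (if x = 0 then -\<infinity> else ereal (log 2 x))"

definition rate_bound :: "real \<Rightarrow> real \<Rightarrow> real \<Rightarrow> real \<Rightarrow> real \<Rightarrow> ereal" where
  "rate_bound A \<sigma> \<gamma> \<rho>0 b =
     ereal ((A + \<sigma>) / (- ln (\<rho>0 * exp (- \<sigma> * \<gamma>)))) *
     max 0 (1 + elog2 (b * \<gamma> * (A + \<sigma>) / ln (1 + \<rho>0 * exp (- (\<sigma> + A) * \<gamma>))))"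

definition trig_fun :: "real \<Rightarrow> real \<Rightarrow> real \<Rightarrow> real" where
  "trig_fun v0 \<sigma> t = v0 * exp (- \<sigma> * t)"

definition right_lim :: "(real \<Rightarrow> real) \<Rightarrow> real \<Rightarrow> real" where
  "right_lim f t = Lim (at_right t) f"

text \<open>
  A quantization policy. A packet is a finite, possibly empty, bit string. The sensor determines
  it causally at a triggering time \<open>t\<close> from the histories of \<open>x\<close> and of the estimate on \<open>[0, t]\<close>
  (encoded as trajectories frozen at \<open>t\<close>) and from \<open>t\<close>. The decoder produces the estimate of the
  error from the reception time and the received packet; it sees neither the triggering time nor
  the delay. Everything known in advance (plant, delay bound, triggering function) may be built
  into the policy.
\<close>

record policy =
  encode :: "(real \<Rightarrow> real) \<Rightarrow> (real \<Rightarrow> real) \<Rightarrow> real \<Rightarrow> bool list"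
  decode :: "real \<Rightarrow> bool list \<Rightarrow> real"

definition frozen_at :: "real \<Rightarrow> (real \<Rightarrow> real) \<Rightarrow> real \<Rightarrow> real" where
  "frozen_at t f = (\<lambda>s. f (max 0 (min s t)))"

text \<open>
  A run on the time interval \<open>[0, horizon)\<close>, where the horizon may be infinite: plant state \<open>x\<close>,
  controller's estimate, control input \<open>u\<close>, and the number (possibly infinite) of triggering times
  with the triggering and reception times themselves. Transmissions are numbered from 0.
\<close>

record run =
  horizon :: ereal
  state :: "real \<Rightarrow> real"
  estimate :: "real \<Rightarrow> real"
  control :: "real \<Rightarrow> real"
  num_trig :: enat
  trig_time :: "nat \<Rightarrow> real"
  recv_time :: "nat \<Rightarrow> real"

definition err :: "run \<Rightarrow> real \<Rightarrow> real" where
  "err w t = state w t - estimate w t"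

definition packet :: "policy \<Rightarrow> run \<Rightarrow> nat \<Rightarrow> bool list" where
  "packet P w k = encode P (frozen_at (trig_time w k) (state w))
     (frozen_at (trig_time w k) (estimate w)) (trig_time w k)"

definition err_est :: "policy \<Rightarrow> run \<Rightarrow> nat \<Rightarrow> real" where
  "err_est P w k = decode P (recv_time w k) (packet P w k)"

text \<open>
  \<open>flow A B u f s t\<close>: on \<open>[s, t]\<close> the increment of \<open>f\<close> is the one prescribed by \<open>f' = A f + B u\<close>,
  in integrated (Caratheodory) form, since the control may be discontinuous, for instance at
  reception times.
\<close>

definition flow :: "real \<Rightarrow> real \<Rightarrow> (real \<Rightarrow> real) \<Rightarrow> (real \<Rightarrow> real) \<Rightarrow> real \<Rightarrow> real \<Rightarrow> bool" where
  "flow A B u f s t \<longleftrightarrow> ((\<lambda>\<tau>. A * f \<tau> + B * u \<tau>) has_integral (f t - f s)) {s..t}"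

text \<open>
  The closed loop under a policy, with arbitrary control and arbitrary delays in \<open>[0, \<gamma>]\<close>.
  Trajectories are left-continuous: at a reception time the estimate has its value before the
  jump, and its right limit is the value after it. So the estimate follows the flow on \<open>[s, t]\<close>
  whenever nothing is received in \<open>[s, t)\<close>.

  Triggering times enumerate in increasing order exactly the times with \<open>\<bar>z t\<bar> = v t\<close>. An infinite
  enumeration may accumulate only at the horizon. A policy producing such accumulation still has
  runs up to the accumulation point, so statements about all runs are not vacuous for it.
\<close>

definition is_run ::
  "real \<Rightarrow> real \<Rightarrow> real \<Rightarrow> real \<Rightarrow> real \<Rightarrow> real \<Rightarrow> policy \<Rightarrow> run \<Rightarrow> bool" where
  "is_run A B L \<gamma> v0 \<sigma> P w \<longleftrightarrow>
     0 < horizon w \<and>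
     \<bar>state w 0\<bar> < L \<and>
     (\<forall>s t. 0 \<le> s \<and> s \<le> t \<and> ereal t < horizon w \<longrightarrow>
        flow A B (control w) (state w) s t) \<and>
     (\<forall>s t. 0 \<le> s \<and> s \<le> t \<and> ereal t < horizon w \<and>
        (\<forall>k. enat k < num_trig w \<longrightarrow> recv_time w k \<notin> {s..<t}) \<longrightarrow>
        flow A B (control w) (estimate w) s t) \<and>
     (\<forall>k. enat k < num_trig w \<and> ereal (recv_time w k) < horizon w \<longrightarrow>
        (estimate w \<longlongrightarrow> err_est P w k + estimate w (recv_time w k)) (at_right (recv_time w k))) \<and>
     strict_mono_on {k. enat k < num_trig w} (trig_time w) \<and>
     trig_time w ` {k. enat k < num_trig w} =
       {t. 0 \<le> t \<and> ereal t < horizon w \<and> \<bar>err w t\<bar> = trig_fun v0 \<sigma> t} \<and>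
     (\<forall>k. enat k < num_trig w \<longrightarrow>
        trig_time w k \<le> recv_time w k \<and> recv_time w k \<le> trig_time w k + \<gamma>)"

text \<open>Meaningful for runs with infinitely many triggering times.\<close>

definition info_rate :: "policy \<Rightarrow> run \<Rightarrow> ereal" where
  "info_rate P w =
     limsup (\<lambda>N. ereal ((\<Sum>k<N. real (length (packet P w k))) /
                         (\<Sum>k<N. trig_time w (Suc k) - trig_time w k)))"

end

theory Submission
  imports Defs
begin

text \<open>The policy makes the error after each reception nonnegative. As the error keeps its sign
  between receptions, only the first packet has to carry a sign, and its additional bits
  do not affect the rate. What remains is to tell the decoder the triggering time up to an error
  \<open>\<delta>\<close> with \<open>e\<^bsup>(A + \<sigma>) \<delta>\<^esup> = 1 + \<rho>\<^sub>0 e\<^bsup>- (\<sigma> + A) \<gamma>\<^esup>\<close>, given that it lies in a window of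
  length \<open>\<gamma>\<close>. Cutting time into cells of length \<open>\<delta>\<close>, labelled cyclically by \<open>2\<^sup>n + 1\<close> bit strings
  of length at most \<open>n\<close>, achieves this as soon as \<open>\<gamma> < 2\<^sup>n \<delta>\<close> and \<open>n > 0\<close>; if \<open>\<gamma> < \<delta>\<close>, empty packets
  suffice. Since the error decreases from \<open>v(t\<^sub>s)\<close> to at most
  \<open>\<rho>\<^sub>0 e\<^bsup>- \<sigma> \<gamma>\<^esup> v(t\<^sub>s)\<close>, triggering times are at least \<open>- ln (\<rho>\<^sub>0 e\<^bsup>- \<sigma> \<gamma>\<^esup>) / (A + \<sigma>)\<close> apart.\<close>

section \<open>The scalar linear differential equation in integrated form\<close>

text \<open>The integral identity makes \<open>e\<close> continuous, hence differentiable with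
  derivative \<open>A * e\<close>; then \<open>e c * exp (- A * (c - s))\<close> has derivative
  0.\<close>

lemma exp_growth_if_integral_eq:
  fixes e :: "real \<Rightarrow> real"
  assumes "s \<le> t"
    and int: "\<And>c. s \<le> c \<Longrightarrow> c \<le> t \<Longrightarrow> ((\<lambda>\<tau>. A * e \<tau>) has_integral (e c - e s)) {s..c}"
  shows "e t = e s * exp (A * (t - s))"
proof -
  let ?I = "\<lambda>c. integral {s..c} (\<lambda>\<tau>. A * e \<tau>)"
  have integrable: "(\<lambda>\<tau>. A * e \<tau>) integrable_on {s..t}"
    using int[of t] \<open>s \<le> t\<close> by blast
  have e_eq: "e c = e s + ?I c" if "c \<in> {s..t}" for c
    using integral_unique[OF int[of c]] that by auto
  have "continuous_on {s..t} (\<lambda>c. e s + ?I c)"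
    by (intro continuous_intros indefinite_integral_continuous_1 integrable)
  then have cont: "continuous_on {s..t} e"
    by (rule continuous_on_eq) (rule e_eq[symmetric])
  have deriv: "(e has_real_derivative A * e x) (at x within {s..t})" if x: "x \<in> {s..t}" for x
  proof -
    have "(?I has_vector_derivative A * e x) (at x within {s..t})"
      by (intro integral_has_vector_derivative continuous_intros cont x)
    then have "((\<lambda>c. e s + ?I c) has_vector_derivative A * e x) (at x within {s..t})"
      by (auto intro: derivative_eq_intros)
    then have "(e has_vector_derivative A * e x) (at x within {s..t})"
      by (rule has_vector_derivative_transform[OF x, rotated]) (rule e_eq)
    then show ?thesis
      by (simp add: has_real_derivative_iff_has_vector_derivative)
  qed
  have "((\<lambda>c. e c * exp (- A * (c - s))) has_real_derivative 0) (at x within {s..t})"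
    if "x \<in> {s..t}" for x
    by (rule derivative_eq_intros deriv[OF that] refl | simp)+
  then obtain k where k: "\<And>c. c \<in> {s..t} \<Longrightarrow> e c * exp (- A * (c - s)) = k"
    using has_field_derivative_zero_constant[of "{s..t}" "\<lambda>c. e c * exp (- A * (c - s))"] by auto
  have "e t * exp (- A * (t - s)) = e s"
    using k[of t] k[of s] \<open>s \<le> t\<close> by simp
  then have "e s * exp (A * (t - s)) = e t * (exp (- A * (t - s)) * exp (A * (t - s)))"
    by (simp only: mult.assoc[symmetric])
  then show ?thesis
    by (simp only: exp_add[symmetric]) simp
qed

section \<open>Coloring of the time axis by short bit strings\<close>

text \<open>Two times of equal color lie in the same cell of length \<open>\<delta>\<close> or in
  cells at least one full cycle of labels apart; the latter forces a distance above
  \<open>2 ^ n * \<delta>\<close>.\<close>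

lemma ex_coloring:
  fixes \<gamma> \<delta> :: real
  assumes "\<delta> > 0" and less: "\<gamma> < 2 ^ n * \<delta>"
  obtains col :: "real \<Rightarrow> bool list"
  where "\<And>t. length (col t) \<le> n"
    and "\<And>s t. col s = col t \<Longrightarrow> s \<le> t \<Longrightarrow> t \<le> s + \<gamma> \<Longrightarrow> t \<le> s + \<delta>"
proof (cases "n = 0")
  case True
  with less show ?thesis
    by (intro that[of "\<lambda>_. []"]) auto
next
  case False
  \<comment> \<open>Times whose cell indices differ by \<open>N\<close> are only guaranteed to be
    more than \<open>(N - 1) * \<delta>\<close> apart, hence one label more than
    \<open>2 ^ n\<close>. Strings shorter than \<open>n\<close> supply it, as
    \<open>n > 0\<close>.\<close>
  define N :: nat where "N = 2 ^ n + 1"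
  let ?B = "{xs :: bool list. set xs \<subseteq> UNIV \<and> length xs \<le> n}"
  have "(\<Sum>i\<le>n. (2::nat) ^ i) = 2 ^ Suc n - 1"
    by (induction n) auto
  then have "card ?B = 2 ^ Suc n - 1"
    by (subst card_lists_length_le) simp_all
  moreover have "(2::nat) \<le> 2 ^ n"
    using False by (cases n) auto
  ultimately have "card {..<N} \<le> card ?B"
    by (simp add: N_def)
  then obtain f where f: "f ` {..<N} \<subseteq> ?B" "inj_on f {..<N}"
    using card_le_inj[of "{..<N}" ?B] finite_lists_length_le[of "UNIV :: bool set" n] by auto
  define c where "c t = nat (\<lfloor>t / \<delta>\<rfloor> mod int N)" for t
  have N: "0 < N"
    by (simp add: N_def)
  then have c: "c t \<in> {..<N}" for t
    by (simp add: c_def nat_less_iff)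
  show ?thesis
  proof (rule that[of "\<lambda>t. f (c t)"])
    show "length (f (c t)) \<le> n" for t
      using f(1) c[of t] by blast
  next
    fix s t assume eq: "f (c s) = f (c t)" and st: "s \<le> t" "t \<le> s + \<gamma>"
    let ?i = "\<lfloor>s / \<delta>\<rfloor>" and ?j = "\<lfloor>t / \<delta>\<rfloor>"
    have "c s = c t"
      using eq f(2) c by (auto dest: inj_onD)
    then have "?j mod int N = ?i mod int N"
      by (simp add: c_def eq_nat_nat_iff N)
    then have dvd: "int N dvd ?j - ?i"
      by (simp only: mod_eq_dvd_iff[symmetric])
    have ij: "?i \<le> ?j"
      using st \<open>\<delta> > 0\<close> by (intro floor_mono divide_right_mono) simp_all
    have diff: "t / \<delta> - s / \<delta> < real_of_int (?j - ?i) + 1" "real_of_int (?j - ?i) - 1 < t / \<delta> - s / \<delta>"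
      by linarith+
    have "?j - ?i = 0"
    proof (rule ccontr)
      assume "?j - ?i \<noteq> 0"
      then have "int N \<le> ?j - ?i"
        using dvd ij by (intro zdvd_imp_le) simp_all
      then have "real N \<le> real_of_int (?j - ?i)"
        by linarith
      then have "2 ^ n < (t - s) / \<delta>"
        using diff by (simp add: N_def diff_divide_distrib)
      then have "2 ^ n * \<delta> < t - s"
        using \<open>\<delta> > 0\<close> by (simp add: pos_less_divide_eq)
      with less st show False by simp
    qed
    then have "(t - s) / \<delta> < 1"
      using diff by (simp add: diff_divide_distrib)
    then show "t \<le> s + \<delta>"
      using \<open>\<delta> > 0\<close> by (simp add: pos_divide_less_eq)
  qed
qed

section \<open>Error dynamics under an arbitrary policy\<close>

locale closed_loop =
  fixes A B L \<gamma> v0 \<sigma> :: real and P :: policy and w :: run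
  assumes A: "A > 0" and v0: "v0 > 0" and \<sigma>: "\<sigma> > 0" and \<gamma>: "\<gamma> \<ge> 0"
    and run: "is_run A B L \<gamma> v0 \<sigma> P w"
    and init: "\<bar>err w 0\<bar> < v0"
begin

abbreviation "T \<equiv> trig_time w"
abbreviation "C \<equiv> recv_time w"
abbreviation "v \<equiv> trig_fun v0 \<sigma>"

lemma v_pos: "v t > 0"
  using v0 by (simp add: trig_fun_def)

lemma v_less: "s < t \<Longrightarrow> v t < v s"
  using v0 \<sigma> by (simp add: trig_fun_def)

lemma v_shift: "v t = exp (\<sigma> * (s - t)) * v s"
  by (simp add: trig_fun_def exp_add[symmetric] algebra_simps)

lemma state_flow: "flow A B (control w) (state w) s t"
  if "0 \<le> s" "s \<le> t" "ereal t < horizon w"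
  using run that unfolding is_run_def by blast

lemma estimate_flow: "flow A B (control w) (estimate w) s t"
  if "0 \<le> s" "s \<le> t" "ereal t < horizon w"
    "\<And>k. enat k < num_trig w \<Longrightarrow> C k \<notin> {s..<t}"
  using run that unfolding is_run_def by blast

lemma estimate_jump:
  "(estimate w \<longlongrightarrow> err_est P w k + estimate w (C k)) (at_right (C k))"
  if "enat k < num_trig w" "ereal (C k) < horizon w"
  using run that unfolding is_run_def by blast

lemma trig_less_iff: "T j < T k \<longleftrightarrow> j < k"
  if "enat j < num_trig w" "enat k < num_trig w"
proof -
  have "strict_mono_on {k. enat k < num_trig w} T"
    using run unfolding is_run_def by blast
  from strict_mono_on_less[OF this] that show ?thesis by simp
qed

lemma trig_image:
  "T ` {k. enat k < num_trig w} = {t. 0 \<le> t \<and> ereal t < horizon w \<and> \<bar>err w t\<bar> = v t}"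
  using run unfolding is_run_def by blast

lemma trig_props: "0 \<le> T k" "ereal (T k) < horizon w" "\<bar>err w (T k)\<bar> = v (T k)"
  if "enat k < num_trig w"
  using that trig_image by blast+

lemma ex_trig:
  assumes "0 \<le> t" "ereal t < horizon w" "\<bar>err w t\<bar> = v t"
  obtains k where "enat k < num_trig w" "T k = t"
proof -
  have "t \<in> T ` {k. enat k < num_trig w}"
    using assms trig_image by blast
  then show ?thesis using that by blast
qed

lemma recv_bounds: "T k \<le> C k" "C k \<le> T k + \<gamma>" if "enat k < num_trig w"
  using run that unfolding is_run_def by blast+

text \<open>The control enters state and estimate alike and cancels in the error.\<close>

lemma err_growth:
  assumes "0 \<le> s" "s \<le> t" "ereal t < horizon w"
    and quiet: "\<And>k. enat k < num_trig w \<Longrightarrow> C k \<notin> {s..<t}"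
  shows "err w t = err w s * exp (A * (t - s))"
proof (rule exp_growth_if_integral_eq[OF \<open>s \<le> t\<close>])
  fix c assume c: "s \<le> c" "c \<le> t"
  have h: "ereal c < horizon w"
    using c assms(3) by (meson ereal_less_eq(3) le_less_trans)
  have "C k \<notin> {s..<c}" if "enat k < num_trig w" for k
    using quiet[OF that] c by auto
  from has_integral_diff[OF state_flow[unfolded flow_def] estimate_flow[unfolded flow_def]]
  have "((\<lambda>\<tau>. (A * state w \<tau> + B * control w \<tau>) - (A * estimate w \<tau> + B * control w \<tau>))
      has_integral ((state w c - state w s) - (estimate w c - estimate w s))) {s..c}"
    using assms(1) c h \<open>\<And>k. enat k < num_trig w \<Longrightarrow> C k \<notin> {s..<c}\<close> by blast
  then show "((\<lambda>\<tau>. A * err w \<tau>) has_integral (err w c - err w s)) {s..c}"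
    by (simp add: err_def algebra_simps)
qed

text \<open>The state is an indefinite integral on an interval to the right of \<open>C k\<close>,
  hence right-continuous there; only the estimate jumps.\<close>

lemma err_jump:
  assumes k: "enat k < num_trig w" and h: "ereal (C k) < horizon w"
  shows "(err w \<longlongrightarrow> err w (C k) - err_est P w k) (at_right (C k))"
proof -
  have nonneg: "0 \<le> C k"
    using trig_props(1) recv_bounds(1) k by fastforce
  obtain d where d: "ereal (C k) < ereal d" "ereal d < horizon w"
    using h ereal_dense2 by blast
  let ?g = "\<lambda>\<tau>. A * state w \<tau> + B * control w \<tau>"
  have int: "(?g has_integral (state w c - state w (C k))) {C k..c}" if "c \<in> {C k..d}" for c
  proof -
    have "ereal c < horizon w"
      using that d(2) by (meson atLeastAtMost_iff ereal_less_eq(3) le_less_trans)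
    then show ?thesis
      using state_flow[of "C k" c] that nonneg by (simp add: flow_def)
  qed
  have "?g integrable_on {C k..d}"
    using int[of d] d by auto
  then have "continuous_on {C k..d} (\<lambda>c. state w (C k) + integral {C k..c} ?g)"
    by (intro continuous_intros indefinite_integral_continuous_1)
  then have "continuous_on {C k..d} (state w)"
    by (rule continuous_on_eq) (simp add: integral_unique[OF int])
  then have "(state w \<longlongrightarrow> state w (C k)) (at (C k) within {C k..d})"
    using d by (simp add: continuous_on_def)
  then have "(state w \<longlongrightarrow> state w (C k)) (at_right (C k))"
    using d by (simp add: at_within_Icc_at_right)
  from tendsto_diff[OF this estimate_jump[OF k h]] show ?thesis
    by (simp add: err_def[abs_def] algebra_simps)
qed

lemma right_lim_err:
  assumes "enat k < num_trig w" "ereal (C k) < horizon w"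
  shows "right_lim (err w) (C k) = err w (C k) - err_est P w k"
  unfolding right_lim_def by (rule tendsto_Lim[OF _ err_jump[OF assms]]) simp

text \<open>\<open>err_growth\<close> cannot start at \<open>C k\<close>, where the error still has
  its value before the jump. It is applied from \<open>s > C k\<close>, and \<open>s\<close> then
  tends to \<open>C k\<close>.\<close>

lemma err_growth_after_jump:
  assumes k: "enat k < num_trig w" and t: "C k < t" "ereal t < horizon w"
    and quiet: "\<And>j. enat j < num_trig w \<Longrightarrow> C j \<notin> {C k<..<t}"
  shows "err w t = (err w (C k) - err_est P w k) * exp (A * (t - C k))"
proof -
  have nonneg: "0 \<le> C k"
    using trig_props(1) recv_bounds(1) k by fastforce
  have h: "ereal (C k) < horizon w"
    using t by (meson ereal_less(2) less_ereal.simps(1) less_trans)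
  have "((\<lambda>s. err w s * exp (A * (t - s))) \<longlongrightarrow>
      (err w (C k) - err_est P w k) * exp (A * (t - C k))) (at_right (C k))"
    by (intro tendsto_intros err_jump k h)
  moreover have "\<forall>\<^sub>F s in at_right (C k). err w s * exp (A * (t - s)) = err w t"
  proof (rule eventually_mono[OF eventually_at_right_real[OF t(1)]])
    fix s assume s: "s \<in> {C k<..<t}"
    show "err w s * exp (A * (t - s)) = err w t"
    proof (rule err_growth[symmetric])
      show "C j \<notin> {s..<t}" if "enat j < num_trig w" for j
        using quiet[OF that] s by auto
    qed (use s nonneg t in auto)
  qed
  ultimately have "((\<lambda>s. err w t) \<longlongrightarrow>
      (err w (C k) - err_est P w k) * exp (A * (t - C k))) (at_right (C k))"
    by (rule Lim_transform_eventually)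
  then show ?thesis
    using tendsto_unique[OF _ _ tendsto_const] by force
qed

text \<open>An error growing exponentially from below \<open>v\<close> must cross \<open>v\<close>, hence trigger, before
  exceeding it.\<close>

lemma err_le_v_if_no_trig:
  assumes "0 \<le> s" "s < t" "ereal t < horizon w" "\<bar>z\<bar> < v s"
    and growth: "\<And>c. s < c \<Longrightarrow> c \<le> t \<Longrightarrow> err w c = z * exp (A * (c - s))"
    and no_trig: "\<And>k. enat k < num_trig w \<Longrightarrow> T k \<notin> {s<..<t}"
  shows "\<bar>err w t\<bar> \<le> v t"
proof (rule ccontr)
  assume exceeds: "\<not> ?thesis"
  define h where "h c = \<bar>z\<bar> * exp (A * (c - s)) - v c" for c
  have "h s \<le> 0"
    using assms(4) by (simp add: h_def)
  moreover have ht: "0 < h t"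
    using exceeds growth[of t] \<open>s < t\<close> by (simp add: h_def abs_mult)
  moreover have "continuous_on {s..t} h"
    unfolding h_def trig_fun_def by (intro continuous_intros)
  ultimately obtain c where c: "s \<le> c" "c \<le> t" "h c = 0"
    using IVT'[of h s 0 t] \<open>s < t\<close> by auto
  have "h s < 0"
    using assms(4) by (simp add: h_def)
  then have strict: "s < c" "c < t"
    using c ht by (auto simp: less_le)
  have "ereal c < horizon w"
    using c(2) assms(3) by (meson ereal_less_eq(3) le_less_trans)
  moreover have "\<bar>err w c\<bar> = v c"
    using growth[of c] strict c(3) by (simp add: h_def abs_mult)
  ultimately obtain k where "enat k < num_trig w" "T k = c"
    using ex_trig[of c] strict assms(1) by auto
  then show False
    using no_trig[of k] strict by simp
qed

end

section \<open>Nonnegative errors after reception: trigger spacing, error bound and rate\<close>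

text \<open>The solution \<open>d\<close> of \<open>\<rho>0 * exp (- \<sigma> * \<gamma>) * exp (A *
  d) = exp (- \<sigma> * d)\<close>: the time an error of this relative size needs to meet the
  decaying \<open>v\<close>. Its reciprocal is the prefactor in \<open>rate_bound\<close>.\<close>

definition min_gap :: "real \<Rightarrow> real \<Rightarrow> real \<Rightarrow> real \<Rightarrow> real" where
  "min_gap A \<sigma> \<gamma> \<rho>0 = - ln (\<rho>0 * exp (- \<sigma> * \<gamma>)) / (A + \<sigma>)"

lemma min_gap_pos:
  assumes "A > 0" "\<sigma> > 0" "\<gamma> \<ge> 0" "0 < \<rho>0" "\<rho>0 < 1"
  shows "min_gap A \<sigma> \<gamma> \<rho>0 > 0"
proof -
  have "\<rho>0 * exp (- \<sigma> * \<gamma>) \<le> \<rho>0 * 1"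
    using assms by (intro mult_left_mono) auto
  then have "\<rho>0 * exp (- \<sigma> * \<gamma>) < 1"
    using assms by linarith
  moreover have "0 < \<rho>0 * exp (- \<sigma> * \<gamma>)"
    using assms by simp
  ultimately have "ln (\<rho>0 * exp (- \<sigma> * \<gamma>)) < 0"
    using ln_less_zero by blast
  then show ?thesis
    using assms by (simp add: min_gap_def divide_neg_pos)
qed

text \<open>The requirement that the error after a reception be nonnegative is what makes the sign of all
  later triggering errors known.\<close>

locale one_sided_loop = closed_loop +
  fixes \<rho>0 :: real
  assumes \<rho>0: "0 < \<rho>0" "\<rho>0 < 1"
    and one_sided: "\<And>k. enat k < num_trig w \<Longrightarrow>
      err w (T k) * exp (A * (C k - T k)) - err_est P w k \<in> {0..\<rho>0 * exp (- \<sigma> * \<gamma>) * v (T k)}"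
begin

abbreviation "jump_err k \<equiv> err w (C k) - err_est P w k"

text \<open>With packet \<open>k\<close> still in flight, the error would grow undisturbed from
  \<open>T k\<close> to \<open>T (Suc k)\<close> while \<open>v\<close> decays, so the two could not
  agree in magnitude at \<open>T (Suc k)\<close>.\<close>

lemma recv_less_trig_Suc:
  assumes k: "enat (Suc k) < num_trig w"
    and before: "\<And>j. j < k \<Longrightarrow> C j < T k"
  shows "C k < T (Suc k)"
proof (rule ccontr)
  assume "\<not> C k < T (Suc k)"
  have k': "enat k < num_trig w"
    using k Suc_ile_eq order_less_imp_le by blast
  have less: "T k < T (Suc k)"
    using trig_less_iff k k' by blast
  have "C j \<notin> {T k..<T (Suc k)}" if j: "enat j < num_trig w" for j
  proof -
    consider "j < k" | "j = k" | "Suc k \<le> j" by linarith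
    then show ?thesis
    proof cases
      case 3
      then have "T (Suc k) \<le> T j"
        using trig_less_iff[OF j k] by linarith
      then show ?thesis using recv_bounds(1)[OF j] by auto
    qed (use before[of j] \<open>\<not> C k < T (Suc k)\<close> in auto)
  qed
  then have "err w (T (Suc k)) = err w (T k) * exp (A * (T (Suc k) - T k))"
    using trig_props(1)[OF k'] trig_props(2)[OF k] less by (intro err_growth) simp_all
  then have "v (T (Suc k)) = v (T k) * exp (A * (T (Suc k) - T k))"
    using trig_props(3)[OF k] trig_props(3)[OF k'] by (simp add: abs_mult)
  moreover have "v (T k) * 1 \<le> v (T k) * exp (A * (T (Suc k) - T k))"
    using A less v_pos by (intro mult_left_mono) (auto simp: less_imp_le)
  ultimately show False
    using v_less[OF less] by linarith
qed

text \<open>At most one packet is in flight at a time; the induction hypothesis provides the premise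
  \<open>before\<close> of the previous lemma.\<close>

lemma recv_less_trig: "enat k < num_trig w \<Longrightarrow> j < k \<Longrightarrow> C j < T k"
proof (induction k arbitrary: j)
  case (Suc k)
  have k: "enat k < num_trig w"
    using Suc.prems(1) Suc_ile_eq order_less_imp_le by blast
  have "C k < T (Suc k)"
    using recv_less_trig_Suc[OF Suc.prems(1)] Suc.IH k by blast
  moreover have "C j < T k" if "j < k"
    using Suc.IH k that by blast
  moreover have "T k \<le> C k"
    using recv_bounds(1) k by blast
  ultimately show ?case
    using Suc.prems(2) by (cases "j = k") auto
qed simp

text \<open>Serves the growth both before and after the reception at \<open>C k\<close>, so only
  that instant is removed.\<close>

lemma no_recv_between:
  assumes k: "enat k < num_trig w" and j: "enat j < num_trig w"
    and later: "\<And>i. enat i < num_trig w \<Longrightarrow> k < i \<Longrightarrow> t \<le> T i"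
  shows "C j \<notin> {T k..<t} - {C k}"
proof -
  consider "j < k" | "j = k" | "k < j" by linarith
  then show ?thesis
  proof cases
    case 1
    then show ?thesis using recv_less_trig[OF k, of j] by auto
  next
    case 3
    then show ?thesis using later[OF j] recv_bounds(1)[OF j] by auto
  qed auto
qed

lemma err_before_recv:
  assumes k: "enat k < num_trig w" and t: "T k \<le> t" "t \<le> C k" "ereal t < horizon w"
  shows "err w t = err w (T k) * exp (A * (t - T k))"
proof (rule err_growth)
  fix j assume j: "enat j < num_trig w"
  have "C j \<notin> {T k..<t} - {C k}"
  proof (rule no_recv_between[OF k j])
    show "t \<le> T i" if "enat i < num_trig w" "k < i" for i
      using recv_less_trig[OF that] t by linarith
  qed
  with t show "C j \<notin> {T k..<t}" by auto
qed (use t trig_props(1)[OF k] in simp_all)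

text \<open>\<open>one_sided\<close> speaks of the triggering error propagated to
  \<open>C k\<close>. Since no other packet is received meanwhile, this is the actual error at
  \<open>C k\<close>, provided \<open>C k\<close> lies before the horizon.\<close>

lemma jump_err_bounds:
  assumes "enat k < num_trig w" "ereal (C k) < horizon w"
  shows "0 \<le> jump_err k" "jump_err k \<le> \<rho>0 * exp (- \<sigma> * \<gamma>) * v (T k)"
  using one_sided[OF assms(1)] err_before_recv[OF assms(1) recv_bounds(1) order_refl] assms by simp_all

lemma err_after_recv:
  assumes k: "enat k < num_trig w" and t: "C k < t" "ereal t < horizon w"
    and later: "\<And>i. enat i < num_trig w \<Longrightarrow> k < i \<Longrightarrow> t \<le> T i"
  shows "err w t = jump_err k * exp (A * (t - C k))"
proof (rule err_growth_after_jump[OF k t])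
  fix j assume "enat j < num_trig w"
  from no_recv_between[OF k this later] show "C j \<notin> {C k<..<t}"
    using recv_bounds(1)[OF k] by auto
qed

lemma err_trig_Suc:
  assumes "enat (Suc k) < num_trig w"
  shows "ereal (C k) < horizon w"
    and "err w (T (Suc k)) = jump_err k * exp (A * (T (Suc k) - C k))"
proof -
  have k: "enat k < num_trig w"
    using assms Suc_ile_eq order_less_imp_le by blast
  have less: "C k < T (Suc k)"
    using recv_less_trig[OF assms] by simp
  then show "ereal (C k) < horizon w"
    using trig_props(2)[OF assms] by (meson ereal_less_eq(3) le_less_trans less_imp_le)
  show "err w (T (Suc k)) = jump_err k * exp (A * (T (Suc k) - C k))"
  proof (rule err_after_recv[OF k less trig_props(2)[OF assms]])
    fix i assume "enat i < num_trig w" "k < i"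
    then show "T (Suc k) \<le> T i"
      using trig_less_iff[of i "Suc k"] assms by fastforce
  qed
qed

text \<open>Growth preserves the nonnegative sign left by the last jump, and a triggering error is
  nonzero. Thus only the first packet may need a sign.\<close>

lemma err_trig_Suc_pos:
  assumes "enat (Suc k) < num_trig w"
  shows "err w (T (Suc k)) > 0"
proof -
  have "enat k < num_trig w"
    using assms Suc_ile_eq order_less_imp_le by blast
  then have "err w (T (Suc k)) \<ge> 0"
    using err_trig_Suc[OF assms] jump_err_bounds(1)[of k] by simp
  then show ?thesis
    using trig_props(3)[OF assms] v_pos[of "T (Suc k)"] by simp
qed

abbreviation "gap \<equiv> min_gap A \<sigma> \<gamma> \<rho>0"

lemma gap_pos: "gap > 0"
  using A \<sigma> \<gamma> \<rho>0 by (rule min_gap_pos)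

text \<open>The error left by reception \<open>k\<close> must grow to \<open>v (T (Suc k))\<close>.
  Letting it grow from \<open>T k\<close> instead of \<open>C k\<close> only enlarges it; logarithms
  then give the gap.\<close>

lemma trig_gap:
  assumes "enat (Suc k) < num_trig w"
  shows "gap \<le> T (Suc k) - T k"
proof -
  let ?d = "T (Suc k) - T k" and ?\<epsilon> = "\<rho>0 * exp (- \<sigma> * \<gamma>)"
  have k: "enat k < num_trig w"
    using assms Suc_ile_eq order_less_imp_le by blast
  have \<epsilon>: "0 < ?\<epsilon>" using \<rho>0 by simp
  have "exp (- \<sigma> * ?d) * v (T k) = v (T (Suc k))"
    using v_shift[of "T (Suc k)" "T k"] by (simp add: algebra_simps)
  also have "\<dots> = jump_err k * exp (A * (T (Suc k) - C k))"
    using trig_props(3)[OF assms] err_trig_Suc_pos[OF assms] err_trig_Suc(2)[OF assms] by simp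
  also have "\<dots> \<le> (?\<epsilon> * v (T k)) * exp (A * ?d)"
    using jump_err_bounds[OF k err_trig_Suc(1)[OF assms]] recv_bounds(1)[OF k] A \<epsilon> v_pos[of "T k"]
    by (intro mult_mono) auto
  finally have "exp (- \<sigma> * ?d) * v (T k) \<le> (?\<epsilon> * exp (A * ?d)) * v (T k)"
    by (simp add: mult_ac)
  then have "exp (- \<sigma> * ?d) \<le> ?\<epsilon> * exp (A * ?d)"
    using v_pos[of "T k"] by simp
  then have "ln (exp (- \<sigma> * ?d)) \<le> ln (?\<epsilon> * exp (A * ?d))"
    using \<epsilon> by (subst ln_le_cancel_iff) auto
  also have "\<dots> = ln ?\<epsilon> + A * ?d"
    using \<epsilon> by (subst ln_mult) auto
  finally have "- ln ?\<epsilon> \<le> (A + \<sigma>) * ?d"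
    by (simp add: algebra_simps)
  then show ?thesis
    using A \<sigma> unfolding min_gap_def by (subst pos_divide_le_eq) (auto simp: mult.commute)
qed

lemma trig_ge: "enat k < num_trig w \<Longrightarrow> real k * gap \<le> T k - T 0"
proof (induction k)
  case (Suc k)
  then have "enat k < num_trig w"
    using Suc_ile_eq order_less_imp_le by blast
  with Suc trig_gap[of k] show ?case
    by (simp add: algebra_simps)
qed simp

text \<open>Triggering times at least \<open>gap\<close> apart cannot accumulate, so the indices of
  those before \<open>t\<close> are bounded and a greatest one exists.\<close>

lemma last_trig_before:
  assumes "enat j < num_trig w" "T j < t"
  obtains k where "enat k < num_trig w" "T k < t"
    and "\<And>i. enat i < num_trig w \<Longrightarrow> k < i \<Longrightarrow> t \<le> T i"
proof -
  let ?Q = "\<lambda>k. enat k < num_trig w \<and> T k < t"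
  have bound: "k \<le> nat \<lceil>t / gap\<rceil>" if "?Q k" for k
  proof -
    have "enat 0 < num_trig w"
      using that by (metis zero_enat_def not_less_zero i0_less)
    then have "real k * gap \<le> t"
      using trig_ge[of k] trig_props(1)[of 0] that by linarith
    then have "real k \<le> t / gap"
      using gap_pos by (simp add: pos_le_divide_eq)
    then show ?thesis by linarith
  qed
  let ?k = "Greatest ?Q"
  have "?Q ?k"
    using GreatestI_nat[of ?Q j] bound assms by blast
  moreover have "t \<le> T i" if "enat i < num_trig w" "?k < i" for i
  proof (rule ccontr)
    assume "\<not> t \<le> T i"
    with that have "?Q i" by simp
    then have "i \<le> ?k"
      by (rule Greatest_le_nat[where P = ?Q]) (rule bound)
    with that show False by linarith
  qed
  ultimately show ?thesis
    using that by blast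
qed

text \<open>The error can exceed \<open>v\<close> only while a packet is in flight, that is for a
  time of at most \<open>\<gamma>\<close>, during which its ratio to \<open>v\<close> grows at rate
  \<open>A + \<sigma>\<close>. Otherwise the crossing argument applies.\<close>

lemma err_bound:
  assumes t: "0 \<le> t" "ereal t < horizon w"
  shows "\<bar>err w t\<bar> \<le> exp ((A + \<sigma>) * \<gamma>) * v t"
proof -
  have weaken: ?thesis if "\<bar>err w t\<bar> \<le> v t"
  proof -
    have "1 * v t \<le> exp ((A + \<sigma>) * \<gamma>) * v t"
      using A \<sigma> \<gamma> v_pos[of t] by (intro mult_right_mono) auto
    with that show ?thesis by linarith
  qed
  consider "t = 0" | "t > 0" "\<And>j. enat j < num_trig w \<Longrightarrow> t \<le> T j"
    | j where "enat j < num_trig w" "T j < t"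
    using t by fastforce
  then show ?thesis
  proof cases
    case 1
    then show ?thesis
      using init by (intro weaken) (simp add: trig_fun_def)
  next
    case 2
    have "\<bar>err w t\<bar> \<le> v t"
    proof (rule err_le_v_if_no_trig[of 0 t "err w 0"])
      fix c assume c: "0 < c" "c \<le> t"
      show "err w c = err w 0 * exp (A * (c - 0))"
      proof (rule err_growth)
        show "ereal c < horizon w"
          using c t by (meson ereal_less_eq(3) le_less_trans)
        show "C j \<notin> {0..<c}" if "enat j < num_trig w" for j
          using 2(2)[OF that] recv_bounds(1)[OF that] c by auto
      qed (use c in auto)
    next
      show "T k \<notin> {0<..<t}" if "enat k < num_trig w" for k
        using 2(2)[OF that] by auto
    qed (use 2 t init in \<open>auto simp: trig_fun_def\<close>)
    then show ?thesis by (rule weaken)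
  next
    case 3
    then obtain k where k: "enat k < num_trig w" "T k < t"
      and later: "\<And>i. enat i < num_trig w \<Longrightarrow> k < i \<Longrightarrow> t \<le> T i"
      using last_trig_before by blast
    show ?thesis
    proof (cases "t \<le> C k")
      case True
      then have "\<bar>err w t\<bar> = v (T k) * exp (A * (t - T k))"
        using err_before_recv[of k t] k t trig_props(3)[OF k(1)] by (simp add: abs_mult)
      also have "\<dots> = exp ((A + \<sigma>) * (t - T k)) * v t"
        using v_shift[of "T k" t] by (simp add: exp_add[symmetric] algebra_simps)
      also have "\<dots> \<le> exp ((A + \<sigma>) * \<gamma>) * v t"
        using A \<sigma> v_pos[of t] True recv_bounds(2)[OF k(1)] by (intro mult_right_mono) auto
      finally show ?thesis .
    next
      case False
      have h: "ereal (C k) < horizon w"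
        using False t by (meson ereal_less_eq(3) le_less_trans linear)
      \<comment> \<open>The factor \<open>exp (- \<sigma> * \<gamma>)\<close> covers the decay of
        \<open>v\<close> during the delay, so that the error after the jump is below
        \<open>v\<close> at the reception time too.\<close>
      have "\<rho>0 * exp (- \<sigma> * \<gamma>) * v (T k) = \<rho>0 * v (T k + \<gamma>)"
        using v_shift[of "T k + \<gamma>" "T k"] by simp
      also have "\<dots> \<le> \<rho>0 * v (C k)"
        using \<rho>0 \<sigma> v0 recv_bounds(2)[OF k(1)] by (simp add: trig_fun_def)
      also have "\<dots> < 1 * v (C k)"
        using \<rho>0 v_pos by (intro mult_strict_right_mono) auto
      finally have small: "\<bar>jump_err k\<bar> < v (C k)"
        using jump_err_bounds[OF k(1) h] by simp
      have "\<bar>err w t\<bar> \<le> v t"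
      proof (rule err_le_v_if_no_trig[OF _ _ t(2) small])
        show "0 \<le> C k"
          using recv_bounds(1)[OF k(1)] trig_props(1)[OF k(1)] by linarith
      next
        fix c assume c: "C k < c" "c \<le> t"
        show "err w c = jump_err k * exp (A * (c - C k))"
        proof (rule err_after_recv[OF k(1) c(1)])
          show "ereal c < horizon w"
            using c t by (meson ereal_less_eq(3) le_less_trans)
          show "c \<le> T i" if "enat i < num_trig w" "k < i" for i
            using later[OF that] c by linarith
        qed
      next
        fix i assume i: "enat i < num_trig w"
        show "T i \<notin> {C k<..<t}"
        proof (cases "k < i")
          case True
          then show ?thesis using later[OF i] by auto
        next
          case False
          then have "T i \<le> T k"
            using trig_less_iff[OF k(1) i] by linarith
          then show ?thesis using recv_bounds(1)[OF k(1)] by auto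
        qed
      qed (use False in auto)
      then show ?thesis by (rule weaken)
    qed
  qed
qed

text \<open>All packets but the first obey the length bound, and the first one contributes a
  constant \<open>c\<close> that vanishes in the average.\<close>

lemma info_rate_le:
  assumes inf: "num_trig w = \<infinity>"
    and short: "\<And>k. err w (T k) > 0 \<Longrightarrow> enat k < num_trig w \<Longrightarrow> length (packet P w k) \<le> n"
  shows "info_rate P w \<le> ereal (real n / gap)"
proof -
  let ?len = "\<lambda>k. real (length (packet P w k))"
  define c where "c = ?len 0"
  have sum_len: "(\<Sum>k<N. ?len k) \<le> c + real N * real n" for N
  proof (induction N)
    case (Suc N)
    show ?case
    proof (cases N)
      case 0
      then show ?thesis by (simp add: c_def)
    next
      case (Suc M)
      then have "?len N \<le> real n"
        using short err_trig_Suc_pos[of M] inf by simp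
      with Suc.IH show ?thesis by (simp add: algebra_simps)
    qed
  qed (simp add: c_def)
  have "(\<Sum>k<N. ?len k) / (\<Sum>k<N. T (Suc k) - T k) \<le> c / gap / real N + real n / gap"
    if "N > 0" for N
  proof -
    have "real N * gap \<le> (\<Sum>k<N. T (Suc k) - T k)"
      using trig_ge[of N] inf by (simp add: sum_lessThan_telescope)
    moreover have "0 < real N * gap"
      using that gap_pos by simp
    moreover have "0 \<le> c + real N * real n"
      by (simp add: c_def)
    ultimately have "(\<Sum>k<N. ?len k) / (\<Sum>k<N. T (Suc k) - T k)
        \<le> (c + real N * real n) / (real N * gap)"
      by (intro frac_le sum_len)
    also have "\<dots> = c / gap / real N + real n / gap"
      using that gap_pos by (simp add: field_simps)
    finally show ?thesis .
  qed
  then have "info_rate P w \<le> limsup (\<lambda>N. ereal (c / gap / real N + real n / gap))"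
    unfolding info_rate_def
    by (intro Limsup_mono eventually_mono[OF eventually_gt_at_top[of 0]]) simp
  also have "\<dots> = ereal (real n / gap)"
  proof (rule lim_imp_Limsup)
    have "(\<lambda>N. c / gap / real N + real n / gap) \<longlonglongrightarrow> 0 + real n / gap"
      by (intro tendsto_intros lim_const_over_n)
    then show "(\<lambda>N. ereal (c / gap / real N + real n / gap)) \<longlonglongrightarrow> ereal (real n / gap)"
      by simp
  qed simp
  finally show ?thesis .
qed

end

section \<open>The quantizer and its precision\<close>

text \<open>The error at time \<open>c\<close> before any jump, had it been triggered with positive
  sign at time \<open>s\<close>.\<close>

definition propagated :: "real \<Rightarrow> real \<Rightarrow> real \<Rightarrow> real \<Rightarrow> real \<Rightarrow> real" where
  "propagated A v0 \<sigma> c s = trig_fun v0 \<sigma> s * exp (A * (c - s))"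

text \<open>\<open>quantizer\<close> colors time by short bit strings and sends the color of the triggering time. For a
  negative triggering error, which can only occur at the first transmission, a prefix makes the
  packet longer than all colors. The decoder takes the latest time compatible with the received
  color (or a time at most \<open>\<delta>\<close> before the triggering time if the error is negative), so that its
  estimate never exceeds the error.\<close>

definition quantizer ::
  "real \<Rightarrow> real \<Rightarrow> real \<Rightarrow> real \<Rightarrow> real \<Rightarrow> nat \<Rightarrow> (real \<Rightarrow> bool list) \<Rightarrow> policy" where
  "quantizer A \<gamma> v0 \<sigma> \<delta> n col =
    \<lparr>encode = (\<lambda>x y t. if x t - y t > 0 then col t else replicate (Suc n) True @ col t),
     decode = (\<lambda>c p. let \<tau> = (\<lambda>q. Sup {t \<in> {c - \<gamma>..c}. col t = q}) in
       if length p \<le> n then propagated A v0 \<sigma> c (\<tau> p)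
       else - propagated A v0 \<sigma> c (\<tau> (drop (Suc n) p) - \<delta>))\<rparr>"

lemma propagated_shift:
  "propagated A v0 \<sigma> c s' = exp ((A + \<sigma>) * (s - s')) * propagated A v0 \<sigma> c s"
  by (simp add: propagated_def trig_fun_def exp_add[symmetric] algebra_simps)

text \<open>Here \<open>s\<close> is the true triggering time and \<open>s'\<close> the guess of the
  decoder; the first part (late guess) is for positive errors, the second (early guess) for negative
  ones. All reduces to the ratio \<open>f\<close>.\<close>

lemma propagated_diff:
  assumes "A > 0" "\<sigma> > 0" "v0 > 0"
    and \<delta>: "exp ((A + \<sigma>) * \<delta>) = 1 + r"
  shows "s \<le> s' \<Longrightarrow> s' \<le> s + \<delta> \<Longrightarrow>
      propagated A v0 \<sigma> c s - propagated A v0 \<sigma> c s' \<in> {0..r * propagated A v0 \<sigma> c s}"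
    and "s' \<le> s \<Longrightarrow> s \<le> s' + \<delta> \<Longrightarrow>
      propagated A v0 \<sigma> c s' - propagated A v0 \<sigma> c s \<in> {0..r * propagated A v0 \<sigma> c s}"
proof -
  have pos: "propagated A v0 \<sigma> c s > 0"
    using assms by (simp add: propagated_def trig_fun_def)
  define f where "f = exp ((A + \<sigma>) * (s - s'))"
  have f: "propagated A v0 \<sigma> c s' = f * propagated A v0 \<sigma> c s"
    unfolding f_def by (rule propagated_shift)
  {
    assume s: "s \<le> s'" "s' \<le> s + \<delta>"
    then have "f \<le> 1"
      using assms by (simp add: f_def mult_nonneg_nonpos)
    moreover have "f > 0" by (simp add: f_def)
    moreover have "1 \<le> (1 + r) * f"
    proof -
      have "(1 + r) * f = exp ((A + \<sigma>) * (s + \<delta> - s'))"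
        unfolding \<delta>[symmetric] f_def exp_add[symmetric] by (simp add: algebra_simps)
      then show ?thesis
        using s assms(1,2) by simp
    qed
    \<comment> \<open>The sign of \<open>r\<close> follows from
      \<open>r * f \<ge> 1 - f \<ge> 0\<close>; then
      \<open>1 - f \<le> r * f \<le> r\<close>.\<close>
    moreover from calculation have "0 \<le> r * f"
      by (simp add: algebra_simps)
    then have "r \<ge> 0"
      using \<open>f > 0\<close> by (simp add: zero_le_mult_iff)
    ultimately have "1 - f \<le> r * f" "r * f \<le> r * 1"
      by (simp add: algebra_simps, intro mult_left_mono)
    then have "1 - f \<le> r" by linarith
    then have "(1 - f) * propagated A v0 \<sigma> c s \<le> r * propagated A v0 \<sigma> c s"
      using pos by simp
    moreover have "0 \<le> (1 - f) * propagated A v0 \<sigma> c s"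
      using pos \<open>f \<le> 1\<close> by simp
    ultimately show "propagated A v0 \<sigma> c s - propagated A v0 \<sigma> c s'
        \<in> {0..r * propagated A v0 \<sigma> c s}"
      by (simp add: f left_diff_distrib)
  }
  {
    assume s: "s' \<le> s" "s \<le> s' + \<delta>"
    then have "1 \<le> f"
      using assms by (simp add: f_def)
    moreover have "f \<le> 1 + r"
      using s assms unfolding \<delta>[symmetric] f_def by simp
    ultimately have "0 \<le> (f - 1) * propagated A v0 \<sigma> c s"
      "(f - 1) * propagated A v0 \<sigma> c s \<le> r * propagated A v0 \<sigma> c s"
      using pos by auto
    then show "propagated A v0 \<sigma> c s' - propagated A v0 \<sigma> c s
        \<in> {0..r * propagated A v0 \<sigma> c s}"
      by (simp add: f left_diff_distrib)
  }
qed

lemma frozen_at_self: "0 \<le> t \<Longrightarrow> frozen_at t f t = f t"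
  by (simp add: frozen_at_def)

lemma packet_quantizer:
  assumes "0 \<le> trig_time w k"
  shows "packet (quantizer A \<gamma> v0 \<sigma> \<delta> n col) w k =
    (if err w (trig_time w k) > 0 then [] else replicate (Suc n) True) @ col (trig_time w k)"
  using assms by (simp add: packet_def quantizer_def frozen_at_self err_def)

text \<open>The true time \<open>s\<close> is itself a candidate, so the supremum is not before it.
  A later candidate is at most \<open>c \<le> s + \<gamma>\<close>, close enough for the coloring
  property.\<close>

lemma latest_compatible:
  fixes col :: "real \<Rightarrow> bool list"
  assumes "\<And>s t. col s = col t \<Longrightarrow> s \<le> t \<Longrightarrow> t \<le> s + \<gamma> \<Longrightarrow> t \<le> s + \<delta>"
    and "s \<le> c" "c \<le> s + \<gamma>" and "\<delta> \<ge> 0"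
  shows "Sup {t \<in> {c - \<gamma>..c}. col t = col s} \<in> {s..s + \<delta>}"
proof -
  let ?S = "{t \<in> {c - \<gamma>..c}. col t = col s}"
  have "s \<in> ?S"
    using assms by simp
  moreover have "t \<le> s + \<delta>" if "t \<in> ?S" for t
    using assms(1)[of s t] assms(2-) that by (cases "s \<le> t") auto
  moreover have "bdd_above ?S"
    by (rule bdd_aboveI[of _ c]) simp
  ultimately show ?thesis
    by (auto intro: cSup_upper cSup_least)
qed

text \<open>Time uncertainty \<open>\<delta>\<close> means a relative error of at most
  \<open>\<rho>0 * exp (- (\<sigma> + A) * \<gamma>)\<close> at reception; the growth
  \<open>exp (A * \<gamma>)\<close> in flight turns this into
  \<open>\<rho>0 * exp (- \<sigma> * \<gamma>)\<close> relative to \<open>v\<close> at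
  triggering.\<close>

lemma quantizer_one_sided:
  assumes loop: "closed_loop A B L \<gamma> v0 \<sigma> (quantizer A \<gamma> v0 \<sigma> \<delta> n col) w"
    and \<rho>0: "0 < \<rho>0" "\<rho>0 < 1"
    and len: "\<And>t. length (col t) \<le> n"
    and col: "\<And>s t. col s = col t \<Longrightarrow> s \<le> t \<Longrightarrow> t \<le> s + \<gamma> \<Longrightarrow> t \<le> s + \<delta>"
    and \<delta>: "exp ((A + \<sigma>) * \<delta>) = 1 + \<rho>0 * exp (- (\<sigma> + A) * \<gamma>)" "\<delta> \<ge> 0"
  shows "one_sided_loop A B L \<gamma> v0 \<sigma> (quantizer A \<gamma> v0 \<sigma> \<delta> n col) w \<rho>0"
proof -
  interpret closed_loop A B L \<gamma> v0 \<sigma> "quantizer A \<gamma> v0 \<sigma> \<delta> n col" w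
    by (rule loop)
  show ?thesis
  proof
    fix k assume k: "enat k < num_trig w"
    let ?s = "T k" and ?c = "C k" and ?r = "\<rho>0 * exp (- (\<sigma> + A) * \<gamma>)"
    let ?m = "propagated A v0 \<sigma> ?c"
    define \<tau> where "\<tau> = Sup {t \<in> {?c - \<gamma>..?c}. col t = col ?s}"
    note bounds = recv_bounds[OF k]
    have \<tau>: "\<tau> \<in> {?s..?s + \<delta>}"
      unfolding \<tau>_def using col bounds \<delta>(2) by (rule latest_compatible)
    have "exp (A * (?c - ?s)) \<le> exp (A * \<gamma>)"
      using A bounds by simp
    then have "?m ?s \<le> exp (A * \<gamma>) * v ?s"
      using v_pos[of ?s] by (simp add: propagated_def)
    then have "?r * ?m ?s \<le> ?r * (exp (A * \<gamma>) * v ?s)"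
      using \<rho>0 by (intro mult_left_mono) auto
    also have "\<dots> = \<rho>0 * exp (- \<sigma> * \<gamma>) * v ?s"
      by (simp add: exp_add[symmetric] algebra_simps)
    finally have r: "?r * ?m ?s \<le> \<rho>0 * exp (- \<sigma> * \<gamma>) * v ?s" .
    note diff = propagated_diff[OF A \<sigma> v0 \<delta>(1)]
    note packet = packet_quantizer[OF trig_props(1)[OF k]]
    \<comment> \<open>The length separates the two formats: colors have at most \<open>n\<close>
      bits, prefixed ones at least \<open>Suc n\<close>.\<close>
    have est: "err_est (quantizer A \<gamma> v0 \<sigma> \<delta> n col) w k =
        (if err w ?s > 0 then ?m \<tau> else - ?m (\<tau> - \<delta>))"
      unfolding err_est_def packet using len by (simp add: quantizer_def \<tau>_def Let_def)
    show "err w ?s * exp (A * (?c - ?s)) - err_est (quantizer A \<gamma> v0 \<sigma> \<delta> n col) w k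
        \<in> {0..\<rho>0 * exp (- \<sigma> * \<gamma>) * v ?s}"
    proof (cases "err w ?s > 0")
      case True
      then have "err w ?s * exp (A * (?c - ?s)) = ?m ?s"
        using trig_props(3)[OF k] by (simp add: propagated_def)
      with True diff(1)[of ?s \<tau> ?c] \<tau> r show ?thesis
        by (simp add: est)
    next
      \<comment> \<open>The guess \<open>\<tau> - \<delta>\<close> is early by at most
        \<open>\<delta>\<close>, so the negative estimate is too large in magnitude and the
        difference is again nonnegative.\<close>
      case False
      then have "err w ?s = - v ?s"
        using trig_props(3)[OF k] by simp
      then have "err w ?s * exp (A * (?c - ?s)) = - ?m ?s"
        by (simp add: propagated_def)
      with False diff(2)[of "\<tau> - \<delta>" ?s ?c] \<tau> r show ?thesis
        by (simp add: est)
    qed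
  qed (use \<rho>0 in auto)
qed

section \<open>The rate condition and the choice of the packet length\<close>

text \<open>Exponentiating removes the logarithm; \<open>R * \<mu>\<close> is the number of bits
  that rate \<open>R\<close> allows per shortest triggering interval.\<close>

lemma rate_bound_le_iff:
  assumes "A > 0" "\<sigma> > 0" "\<gamma> \<ge> 0" "0 < \<rho>0" "\<rho>0 < 1" "b > 0"
    and \<delta>_def: "\<delta> = ln (1 + \<rho>0 * exp (- (\<sigma> + A) * \<gamma>)) / (A + \<sigma>)"
    and \<mu>_def: "\<mu> = min_gap A \<sigma> \<gamma> \<rho>0"
  shows "rate_bound A \<sigma> \<gamma> \<rho>0 b \<le> ereal R \<longleftrightarrow> 0 \<le> R * \<mu> \<and> 2 * b * \<gamma> \<le> 2 powr (R * \<mu>) * \<delta>"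
proof -
  have "\<mu> > 0"
    unfolding \<mu>_def using assms(1-5) by (rule min_gap_pos)
  let ?l = "ln (1 + \<rho>0 * exp (- (\<sigma> + A) * \<gamma>))"
  have l: "?l > 0"
    using assms(4) by (intro ln_gt_zero) simp
  then have \<delta>: "\<delta> > 0"
    using assms(1,2) by (simp add: \<delta>_def)
  have x: "b * \<gamma> * (A + \<sigma>) / ?l = b * \<gamma> / \<delta>"
    using assms(1,2) l by (simp add: \<delta>_def field_simps)
  have \<mu>: "(A + \<sigma>) / (- ln (\<rho>0 * exp (- \<sigma> * \<gamma>))) = 1 / \<mu>"
    by (simp add: \<mu>_def min_gap_def)
  show ?thesis
  proof (cases "\<gamma> = 0")
    \<comment> \<open>Here \<open>elog2 0 = -\<infinity>\<close>, so the maximum and the bound are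
      0.\<close>
    case True
    then show ?thesis
      using \<delta> \<open>\<mu> > 0\<close> by (simp add: rate_bound_def elog2_def zero_ereal_def[symmetric] zero_le_mult_iff)
  next
    case False
    then have y: "b * \<gamma> / \<delta> > 0"
      using assms(3,6) \<delta> by simp
    then have elog: "elog2 (b * \<gamma> / \<delta>) = ereal (log 2 (b * \<gamma> / \<delta>))"
      by (auto simp: elog2_def)
    have "rate_bound A \<sigma> \<gamma> \<rho>0 b = ereal (1 / \<mu> * max 0 (1 + log 2 (b * \<gamma> / \<delta>)))"
      unfolding rate_bound_def x \<mu> elog by (simp add: one_ereal_def zero_ereal_def ereal_max[symmetric] del: ereal_max)
    then have "rate_bound A \<sigma> \<gamma> \<rho>0 b \<le> ereal R \<longleftrightarrow> max 0 (1 + log 2 (b * \<gamma> / \<delta>)) \<le> R * \<mu>"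
      using \<open>\<mu> > 0\<close> by (simp add: field_simps)
    also have "\<dots> \<longleftrightarrow> 0 \<le> R * \<mu> \<and> log 2 (2 * (b * \<gamma> / \<delta>)) \<le> R * \<mu>"
      using y by (subst log_mult) auto
    also have "log 2 (2 * (b * \<gamma> / \<delta>)) \<le> R * \<mu> \<longleftrightarrow> 2 * (b * \<gamma> / \<delta>) \<le> 2 powr (R * \<mu>)"
      using y by (subst log_le_iff) auto
    also have "\<dots> \<longleftrightarrow> 2 * b * \<gamma> \<le> 2 powr (R * \<mu>) * \<delta>"
      using \<delta> by (simp add: field_simps)
    finally show ?thesis .
  qed
qed

theorem theorem3:
  fixes A B L \<gamma> v0 \<sigma> \<rho>0 b R :: real
  assumes "A > 0" and "B \<noteq> 0" and "\<gamma> \<ge> 0" and "v0 > 0" and "\<sigma> > 0"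
    and "0 < \<rho>0" and "\<rho>0 < 1" and "b > 1"
    and "ereal R \<ge> rate_bound A \<sigma> \<gamma> \<rho>0 b"
  shows "\<exists>P :: policy. \<forall>w :: run. is_run A B L \<gamma> v0 \<sigma> P w \<and> \<bar>err w 0\<bar> < v0 \<longrightarrow>
      (\<forall>k. enat k < num_trig w \<and> ereal (recv_time w k) < horizon w \<longrightarrow>
         \<bar>right_lim (err w) (recv_time w k)\<bar> = \<bar>err w (recv_time w k) - err_est P w k\<bar> \<and>
         \<bar>err w (recv_time w k) - err_est P w k\<bar>
           \<le> \<rho>0 * exp (- \<sigma> * \<gamma>) * trig_fun v0 \<sigma> (trig_time w k)) \<and>
      (\<forall>t. 0 \<le> t \<and> ereal t < horizon w \<longrightarrow>
         \<bar>err w t\<bar> \<le> v0 * exp ((A + \<sigma>) * \<gamma>) * exp (- \<sigma> * t)) \<and>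
      (num_trig w = \<infinity> \<longrightarrow> info_rate P w \<le> ereal R)"
proof -
  define \<delta> where "\<delta> = ln (1 + \<rho>0 * exp (- (\<sigma> + A) * \<gamma>)) / (A + \<sigma>)"
  define \<mu> where "\<mu> = min_gap A \<sigma> \<gamma> \<rho>0"
  define n where "n = nat \<lfloor>R * \<mu>\<rfloor>"
  have "\<mu> > 0"
    unfolding \<mu>_def using assms by (intro min_gap_pos)
  have "\<delta> > 0"
    unfolding \<delta>_def using assms by (intro divide_pos_pos ln_gt_zero) auto
  have exp_\<delta>: "exp ((A + \<sigma>) * \<delta>) = 1 + \<rho>0 * exp (- (\<sigma> + A) * \<gamma>)"
  proof -
    have "(A + \<sigma>) * \<delta> = ln (1 + \<rho>0 * exp (- (\<sigma> + A) * \<gamma>))"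
      using assms by (simp add: \<delta>_def)
    then show ?thesis
      using assms by (simp add: add_pos_pos)
  qed
  have R: "0 \<le> R * \<mu>" "2 * b * \<gamma> \<le> 2 powr (R * \<mu>) * \<delta>"
    using rate_bound_le_iff[OF _ _ _ _ _ _ \<delta>_def \<mu>_def, of b R] assms by simp_all
  have n: "real n \<le> R * \<mu>" "R * \<mu> < real (Suc n)"
    using R(1) unfolding n_def by linarith+
  \<comment> \<open>Rounding \<open>R * \<mu>\<close> down to \<open>n\<close> loses less than one
    bit, which the summand 1 in \<open>rate_bound\<close>, here the factor 2, makes up for.\<close>
  have "2 * \<gamma> \<le> 2 * b * \<gamma>"
    using assms by (simp add: mult_right_mono)
  also have "\<dots> \<le> 2 powr (R * \<mu>) * \<delta>"
    by (rule R(2))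
  also have "\<dots> < 2 powr real (Suc n) * \<delta>"
    using n(2) \<open>\<delta> > 0\<close> by (intro mult_strict_right_mono) auto
  also have "\<dots> = 2 * (2 ^ n * \<delta>)"
    by (subst powr_realpow) auto
  finally have "\<gamma> < 2 ^ n * \<delta>"
    by simp
  then obtain col :: "real \<Rightarrow> bool list" where col: "\<And>t. length (col t) \<le> n"
      "\<And>s t. col s = col t \<Longrightarrow> s \<le> t \<Longrightarrow> t \<le> s + \<gamma> \<Longrightarrow> t \<le> s + \<delta>"
    using ex_coloring[OF \<open>\<delta> > 0\<close>] by blast
  show ?thesis
  proof (intro exI[of _ "quantizer A \<gamma> v0 \<sigma> \<delta> n col"] allI impI)
    let ?P = "quantizer A \<gamma> v0 \<sigma> \<delta> n col"
    fix w assume w: "is_run A B L \<gamma> v0 \<sigma> ?P w \<and> \<bar>err w 0\<bar> < v0"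
    then have "closed_loop A B L \<gamma> v0 \<sigma> ?P w"
      using assms by unfold_locales auto
    then interpret one_sided_loop A B L \<gamma> v0 \<sigma> ?P w \<rho>0
      using assms col exp_\<delta> \<open>\<delta> > 0\<close> by (intro quantizer_one_sided) auto
    have "length (packet ?P w k) \<le> n" if "err w (T k) > 0" "enat k < num_trig w" for k
      using packet_quantizer[OF trig_props(1)[OF that(2)]] that(1) col(1) by simp
    then have "info_rate ?P w \<le> ereal (real n / \<mu>)" if "num_trig w = \<infinity>"
      using info_rate_le[OF that, of n] that by (simp add: \<mu>_def)
    moreover have "real n / \<mu> \<le> R"
      using n(1) \<open>\<mu> > 0\<close> by (simp add: field_simps)
    ultimately have "num_trig w = \<infinity> \<longrightarrow> info_rate ?P w \<le> ereal R"
      by (meson ereal_less_eq(3) order_trans)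
    then show "(\<forall>k. enat k < num_trig w \<and> ereal (recv_time w k) < horizon w \<longrightarrow>
         \<bar>right_lim (err w) (recv_time w k)\<bar> = \<bar>err w (recv_time w k) - err_est ?P w k\<bar> \<and>
         \<bar>err w (recv_time w k) - err_est ?P w k\<bar>
           \<le> \<rho>0 * exp (- \<sigma> * \<gamma>) * trig_fun v0 \<sigma> (trig_time w k)) \<and>
      (\<forall>t. 0 \<le> t \<and> ereal t < horizon w \<longrightarrow>
         \<bar>err w t\<bar> \<le> v0 * exp ((A + \<sigma>) * \<gamma>) * exp (- \<sigma> * t)) \<and>
      (num_trig w = \<infinity> \<longrightarrow> info_rate ?P w \<le> ereal R)"
      using right_lim_err jump_err_bounds err_bound by (simp add: trig_fun_def mult_ac)
  qed
qed

end
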